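(* Let $P(\lambda)=\sum_{i=0}^kP_i\,n_i(\lambda)$ be an $n\times n$ regular matrix polynomial (of grade $k$) expressed in the Newton basis associated with nodes $\{x_1,\ldots,x_k\}$, and let $\lambda_0$ be an eigenvalue of $P(\lambda)$. Let $0\le\mu\le k-1$, let $A\in\mathbb{C}^{(\mu+1)n\times(k-\mu-1)n}$, $B\in\mathbb{C}^{\mu n\times(k-\mu)n}$, and let $$N(\lambda)=\begin{bmatrix}M_\mu^N(\lambda)+AK_1^N(\lambda)+K_2^N(\lambda)^TB&K_2^N(\lambda)^T\\ K_1^N(\lambda)&0\end{bmatrix}.$$ Let $z$ and $\omega$ be, respectively, a right and a left eigenvector of $N(\lambda)$ associated with $\lambda_0$, regarded as block vectors with $k$ block entries $z(i)$, $\omega(i)$ of length $n$. 1. Assume $\lambda_0$ is finite. Then: - $z(k-\mu)$ is a right eigenvector of $P(\lambda)$ associated with $\lambda_0$. If, in addition, $\lambda_0\notin\{x_{\mu+1},\ldots,x_{k-1}\}$, then $z(1),z(2),\ldots,z(k-\mu)$ are all right eigenvectors of $P(\lambda)$ associated with $\lambda_0$. - $\omega(\mu+1)$ is a left eigenvector of $P(\lambda)$ associated with $\lambda_0$. If, in addition, $\lambda_0\notin\{x_1,\ldots,x_\mu\}$, then $\omega(1),\omega(2),\ldots,\omega(\mu+1)$ are all left eigenvectors of $P(\lambda)$ associated with $\lambda_0$. 2. Assume $\lambda_0$ is infinite. Then $z(1)$ is a right eigenvector, and $\omega(1)$ is a left eigenvector, of $P(\lambda)$ associated with $\lambda_0$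.
   Context: Newton setting (here $m=n$). Let $k\ge1$ and $x_1,\ldots,x_k\in\mathbb{C}$ be distinct nodes. Put $\gamma_j(\lambda)=\lambda-x_j$; the Newton polynomials are $n_0(\lambda)=1$, $n_j(\lambda)=\prod_{\ell=1}^j\gamma_\ell(\lambda)$. For $0\le\mu\le k-1$, $$K_1^N(\lambda)=\begin{bmatrix}-I_n&\gamma_{k-1}(\lambda)I_n\\&-I_n&\gamma_{k-2}(\lambda)I_n\\&&\ddots&\ddots\\&&&-I_n&\gamma_{\mu+1}(\lambda)I_n\end{bmatrix},\quad K_2^N(\lambda)=\begin{bmatrix}-I_n&\gamma_{\mu}(\lambda)I_n\\&-I_n&\gamma_{\mu-1}(\lambda)I_n\\&&\ddots&\ddots\\&&&-I_n&\gamma_{1}(\lambda)I_n\end{bmatrix},$$ of sizes $(k-\mu-1)n\times(k-\mu)n$ and $\mu n\times(\mu+1)n$ ($K_1^N$ is empty if $\mu=k-1$, $K_2^N$ is empty if $\mu=0$). $M_\mu^N(\lambda)$ is the $(\mu+1)\times(k-\mu)$ block matrix with $n\times n$ blocks: if $\mu\le k-2$, its first block row is $[\gamma_k(\lambda)P_k+P_{k-1},P_{k-2},\ldots,P_{\mu+1},P_\mu]$, its last block column has, from top to bottom, blocks $P_\mu,P_{\mu-1},\ldots,P_0$, and all other blocks are $0$; if $\mu=k-1$, it is the block column with blocks $\gamma_k(\lambda)P_k+P_{k-1},P_{k-2},\ldots,P_0$. A square matrix polynomial is regular if its determinant is not identically zero. $\lambda_0\in\mathbb{C}$ is a finite eigenvalue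 of $P$ if $P(\lambda_0)$ is singular; a right (left) eigenvector is a nonzero $x$ with $P(\lambda_0)x=0$ (nonzero $y$ with $y^TP(\lambda_0)=0$, plain transpose). For $P$ of grade $k$, $\mathrm{rev}_kP(\lambda)=\lambda^kP(1/\lambda)$; $P$ has an infinite eigenvalue if $0$ is an eigenvalue of $\mathrm{rev}_kP$, and the associated right/left eigenvectors are those of $\mathrm{rev}_kP$ at $0$. For a pencil $N(\lambda)$ the same definitions are used with $k$ replaced by $1$. *)

theory Defs
  imports "Jordan_Normal_Form.Matrix" "Jordan_Normal_Form.Determinant"
begin

section \<open>Matrix polynomials and their eigenvectors\<close>

text \<open>A matrix polynomial is a matrix over \<^typ>\<open>complex poly\<close>.\<close>

definition poly_mat_at :: "complex poly mat \<Rightarrow> complex \<Rightarrow> complex mat" where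
  "poly_mat_at P c = map_mat (\<lambda>p. poly p c) P"

definition const_poly_mat :: "complex mat \<Rightarrow> complex poly mat" where
  "const_poly_mat A = map_mat (\<lambda>c. [:c:]) A"

definition regular_poly_mat :: "complex poly mat \<Rightarrow> bool" where
  "regular_poly_mat P \<longleftrightarrow> square_mat P \<and> det P \<noteq> 0"

text \<open>
  The grade \<open>k\<close> is an explicit parameter, since it may exceed the degree. (The library's
  \<^const>\<open>reflect_poly\<close> reverses with respect to the degree instead.)
\<close>

definition rev_grade :: "nat \<Rightarrow> complex poly \<Rightarrow> complex poly" where
  "rev_grade k p = (\<Sum>i\<le>k. monom (coeff p (k - i)) i)"

lemma poly_rev_grade:
  assumes "degree p \<le> k" and "c \<noteq> 0"
  shows "poly (rev_grade k p) c = c ^ k * poly p (1 / c)"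
proof -
  have "poly p (1 / c) = (\<Sum>i\<le>k. coeff p i * (1 / c) ^ i)"
    using assms(1) by (subst poly_altdef, intro sum.mono_neutral_left) (auto simp: coeff_eq_0)
  then have "c ^ k * poly p (1 / c) = (\<Sum>i\<le>k. c ^ k * (coeff p i * (1 / c) ^ i))"
    by (simp add: sum_distrib_left)
  also have "\<dots> = (\<Sum>i\<le>k. coeff p i * c ^ (k - i))"
    using assms(2) by (intro sum.cong) (auto simp: power_diff power_one_over field_simps)
  also have "\<dots> = (\<Sum>i\<le>k. coeff p (k - i) * c ^ i)"
    by (rule sum.reindex_bij_witness[where i = "\<lambda>i. k - i" and j = "\<lambda>i. k - i"]) auto
  finally show ?thesis
    by (simp add: rev_grade_def poly_sum poly_monom)
qed

definition rev_poly_mat :: "nat \<Rightarrow> complex poly mat \<Rightarrow> complex poly mat" where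
  "rev_poly_mat k P = map_mat (rev_grade k) P"

datatype eigval = Fin complex | Infty

fun mat_at_eigval :: "nat \<Rightarrow> complex poly mat \<Rightarrow> eigval \<Rightarrow> complex mat" where
  "mat_at_eigval k P (Fin c) = poly_mat_at P c"
| "mat_at_eigval k P Infty = poly_mat_at (rev_poly_mat k P) 0"

definition poly_eigenvalue :: "nat \<Rightarrow> complex poly mat \<Rightarrow> eigval \<Rightarrow> bool" where
  "poly_eigenvalue k P e \<longleftrightarrow> square_mat P \<and> \<not> invertible_mat (mat_at_eigval k P e)"

definition right_eigenvector :: "nat \<Rightarrow> complex poly mat \<Rightarrow> eigval \<Rightarrow> complex vec \<Rightarrow> bool" where
  "right_eigenvector k P e v \<longleftrightarrow>
     v \<in> carrier_vec (dim_col P) \<and> v \<noteq> 0\<^sub>v (dim_col P) \<and>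
     mat_at_eigval k P e *\<^sub>v v = 0\<^sub>v (dim_row P)"

text \<open>Plain transpose: no complex conjugation.\<close>

definition left_eigenvector :: "nat \<Rightarrow> complex poly mat \<Rightarrow> eigval \<Rightarrow> complex vec \<Rightarrow> bool" where
  "left_eigenvector k P e v \<longleftrightarrow>
     v \<in> carrier_vec (dim_row P) \<and> v \<noteq> 0\<^sub>v (dim_row P) \<and>
     mat_of_row v * mat_at_eigval k P e = 0\<^sub>m 1 (dim_col P)"


section \<open>Block matrices and block vectors\<close>

text \<open>
  \<open>block_mat n r c F\<close> has \<open>r\<close> block rows and \<open>c\<close> block columns; its \<open>n \<times> n\<close> block in block
  position \<open>(i, j)\<close>, \<open>1 \<le> i \<le> r\<close>, \<open>1 \<le> j \<le> c\<close>, is \<open>F i j\<close>.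
  Block indices start at 1, entry indices at 0.
\<close>

definition block_mat :: "nat \<Rightarrow> nat \<Rightarrow> nat \<Rightarrow> (nat \<Rightarrow> nat \<Rightarrow> 'a mat) \<Rightarrow> 'a mat" where
  "block_mat n r c F =
     mat (r * n) (c * n) (\<lambda>(a, b). F (a div n + 1) (b div n + 1) $$ (a mod n, b mod n))"

definition block_vec :: "nat \<Rightarrow> 'a vec \<Rightarrow> nat \<Rightarrow> 'a vec" where
  "block_vec n v i = vec n (\<lambda>a. v $ ((i - 1) * n + a))"


section \<open>Newton basis\<close>

definition newton_gamma :: "(nat \<Rightarrow> complex) \<Rightarrow> nat \<Rightarrow> complex poly" where
  "newton_gamma x j = [:- x j, 1:]"

definition newton_poly :: "(nat \<Rightarrow> complex) \<Rightarrow> nat \<Rightarrow> complex poly" where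
  "newton_poly x j = (\<Prod>l = 1..j. newton_gamma x l)"

definition newton_poly_mat ::
    "nat \<Rightarrow> nat \<Rightarrow> (nat \<Rightarrow> complex) \<Rightarrow> (nat \<Rightarrow> complex mat) \<Rightarrow> complex poly mat" where
  "newton_poly_mat n k x P =
     mat n n (\<lambda>(a, b). \<Sum>i = 0..k. smult (P i $$ (a, b)) (newton_poly x i))"

definition newton_K1 :: "nat \<Rightarrow> nat \<Rightarrow> nat \<Rightarrow> (nat \<Rightarrow> complex) \<Rightarrow> complex poly mat" where
  "newton_K1 n k \<mu> x = block_mat n (k - \<mu> - 1) (k - \<mu>) (\<lambda>i j.
     if j = i then - 1\<^sub>m n
     else if j = i + 1 then newton_gamma x (k - i) \<cdot>\<^sub>m 1\<^sub>m n
     else 0\<^sub>m n n)"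

definition newton_K2 :: "nat \<Rightarrow> nat \<Rightarrow> (nat \<Rightarrow> complex) \<Rightarrow> complex poly mat" where
  "newton_K2 n \<mu> x = block_mat n \<mu> (\<mu> + 1) (\<lambda>i j.
     if j = i then - 1\<^sub>m n
     else if j = i + 1 then newton_gamma x (\<mu> + 1 - i) \<cdot>\<^sub>m 1\<^sub>m n
     else 0\<^sub>m n n)"

text \<open>
  The case distinction also covers \<open>\<mu> = k - 1\<close>: there is then a single block column, which is
  both the first and the last one, and \<open>\<mu> + 1 - i = k - i\<close>.
\<close>

definition newton_M ::
    "nat \<Rightarrow> nat \<Rightarrow> nat \<Rightarrow> (nat \<Rightarrow> complex) \<Rightarrow> (nat \<Rightarrow> complex mat) \<Rightarrow> complex poly mat" where
  "newton_M n k \<mu> x P = block_mat n (\<mu> + 1) (k - \<mu>) (\<lambda>i j.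
     if i = 1 \<and> j = 1
     then newton_gamma x k \<cdot>\<^sub>m const_poly_mat (P k) + const_poly_mat (P (k - 1))
     else if i = 1 then const_poly_mat (P (k - j))
     else if j = k - \<mu> then const_poly_mat (P (\<mu> + 1 - i))
     else 0\<^sub>m n n)"

end

theory Submission
  imports Defs
begin

text \<open>
  Write \<open>K\<^sub>1\<close>, \<open>K\<^sub>2\<close>, \<open>M\<close> for the values of the blocks of the pencil at the eigenvalue. The null space of
  \<open>K\<^sub>i\<close> is the column space of an explicit block column \<open>L\<^sub>i\<close> of scalar blocks, \<open>K\<^sub>2\<^sup>T\<close> is injective,
  and \<open>L\<^sub>2\<^sup>T M L\<^sub>1\<close> is the value of \<open>P\<close>. The lower block row of the equation for a right eigenvector
  \<open>z\<close> makes the upper part of \<open>z\<close> equal to \<open>L\<^sub>1 p\<close> for some \<open>p\<close>. Multiplying the upper block row by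
  \<open>L\<^sub>2\<^sup>T\<close> then removes \<open>A\<close>, \<open>B\<close> and the lower part of \<open>z\<close>, and leaves \<open>P p = 0\<close>. If \<open>p\<close> were 0, then
  injectivity of \<open>K\<^sub>2\<^sup>T\<close> would give \<open>z = 0\<close>. The transposed pencil has the same form with the two
  indices exchanged, which gives the left eigenvectors.
\<close>

section \<open>Block matrices\<close>

text \<open>Passage from scalar indices to pairs of a block index, counted from 1, and a position
  inside the block, counted from 0. Induction on the number of blocks splits off the last
  \<open>n\<close> summands.\<close>

lemma sum_blocks:
  fixes f :: "nat \<Rightarrow> 'a::comm_monoid_add"
  shows "(\<Sum>t = 0..<r * n. f t) = (\<Sum>i = 1..r. \<Sum>a = 0..<n. f ((i - 1) * n + a))"
proof (induction r)
  case (Suc r)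
  have "{0..<Suc r * n} = {0..<r * n} \<union> {r * n..<r * n + n}"
    by auto
  then have "sum f {0..<Suc r * n} = sum f {0..<r * n} + sum f {r * n..<r * n + n}"
    by (simp add: sum.union_disjoint)
  moreover have "sum f {r * n..<r * n + n} = (\<Sum>a = 0..<n. f (r * n + a))"
    using sum.shift_bounds_nat_ivl[of f 0 "r * n" n] by (simp add: add.commute)
  ultimately show ?case
    using Suc.IH by simp
qed simp

lemma block_index_less:
  fixes a i n r :: nat
  assumes "i \<in> {1..r}" "a < n"
  shows "(i - 1) * n + a < r * n"
proof -
  have "(i - 1) * n + a < i * n"
    using assms by (cases i) auto
  also have "\<dots> \<le> r * n"
    using assms by (intro mult_right_mono) auto
  finally show ?thesis .
qed

lemma block_indexE:
  fixes n r t :: nat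
  assumes "t < r * n"
  obtains i a where "i \<in> {1..r}" "a < n" "t = (i - 1) * n + a"
proof
  have "n > 0" using assms by (cases n) auto
  then show "t mod n < n" by simp
  show "t div n + 1 \<in> {1..r}"
    using assms by (auto simp: less_mult_imp_div_less Suc_le_eq)
  show "t = (t div n + 1 - 1) * n + t mod n" by simp
qed

lemma dim_block_mat [simp]:
  "dim_row (block_mat n r c F) = r * n"
  "dim_col (block_mat n r c F) = c * n"
  by (simp_all add: block_mat_def)

lemma block_mat_carrier [simp]: "block_mat n r c F \<in> carrier_mat (r * n) (c * n)"
  by (simp add: block_mat_def)

lemma block_mat_index:
  assumes "i \<in> {1..r}" "j \<in> {1..c}" "a < n" "b < n"
  shows "block_mat n r c F $$ ((i - 1) * n + a, (j - 1) * n + b) = F i j $$ (a, b)"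
  using assms block_index_less[of i r a n] block_index_less[of j c b n]
  by (simp add: block_mat_def)

lemma block_mat_eqI:
  assumes "A \<in> carrier_mat (r * n) (c * n)" "B \<in> carrier_mat (r * n) (c * n)"
    and eq: "\<And>i j a b. i \<in> {1..r} \<Longrightarrow> j \<in> {1..c} \<Longrightarrow> a < n \<Longrightarrow> b < n \<Longrightarrow>
      A $$ ((i - 1) * n + a, (j - 1) * n + b) = B $$ ((i - 1) * n + a, (j - 1) * n + b)"
  shows "A = B"
proof (rule eq_matI)
  fix s t assume "s < dim_row B" "t < dim_col B"
  then have "s < r * n" "t < c * n" using assms by auto
  then show "A $$ (s, t) = B $$ (s, t)"
    by (elim block_indexE) (simp only: eq)
qed (use assms in auto)

lemma index_transpose_block_mat:
  assumes "i \<in> {1..c}" "j \<in> {1..r}" "a < n" "b < n"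
  shows "(block_mat n r c F)\<^sup>T $$ ((i - 1) * n + a, (j - 1) * n + b) = F j i $$ (b, a)"
  using assms block_index_less[of i c a n] block_index_less[of j r b n]
  by (simp add: block_mat_index del: One_nat_def)

lemma block_vec_carrier [simp]: "block_vec n v i \<in> carrier_vec n"
  by (simp add: block_vec_def)

lemma index_block_vec [simp]: "a < n \<Longrightarrow> block_vec n v i $ a = v $ ((i - 1) * n + a)"
  by (simp add: block_vec_def)

lemma block_vec_eqI:
  assumes "v \<in> carrier_vec (r * n)" "w \<in> carrier_vec (r * n)"
    and eq: "\<And>i a. i \<in> {1..r} \<Longrightarrow> a < n \<Longrightarrow> v $ ((i - 1) * n + a) = w $ ((i - 1) * n + a)"
  shows "v = w"
proof (rule eq_vecI)
  fix t assume "t < dim_vec w"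
  then have "t < r * n" using assms by auto
  then show "v $ t = w $ t"
    by (elim block_indexE) (simp only: eq)
qed (use assms in auto)

section \<open>Matrix products expanded over blocks\<close>

lemma mult_mat_index_blocks:
  assumes "A \<in> carrier_mat nr (c * n)" "B \<in> carrier_mat (c * n) nc" "s < nr" "t < nc"
  shows "(A * B) $$ (s, t) =
    (\<Sum>j = 1..c. \<Sum>b = 0..<n. A $$ (s, (j - 1) * n + b) * B $$ ((j - 1) * n + b, t))"
proof -
  have "(A * B) $$ (s, t) = (\<Sum>l = 0..<c * n. A $$ (s, l) * B $$ (l, t))"
    using assms by (simp add: scalar_prod_def)
  then show ?thesis by (simp only: sum_blocks)
qed

lemma mult_mat_vec_index_blocks:
  assumes "A \<in> carrier_mat nr (c * n)" "v \<in> carrier_vec (c * n)" "s < nr"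
  shows "(A *\<^sub>v v) $ s =
    (\<Sum>j = 1..c. \<Sum>b = 0..<n. A $$ (s, (j - 1) * n + b) * v $ ((j - 1) * n + b))"
proof -
  have "(A *\<^sub>v v) $ s = (\<Sum>l = 0..<c * n. A $$ (s, l) * v $ l)"
    using assms by (simp add: scalar_prod_def)
  then show ?thesis by (simp only: sum_blocks)
qed

section \<open>Bidiagonal block matrices and their kernels\<close>

text \<open>Common shape of both \<open>K\<^sub>1\<close> and \<open>K\<^sub>2\<close> at an
  eigenvalue. The diagonal carries a parameter \<open>h\<close> instead of 1 so that infinity is
  covered as well; the order of the nodes is left to \<open>g\<close>.\<close>

definition bidiag_mat :: "nat \<Rightarrow> nat \<Rightarrow> 'a::field \<Rightarrow> (nat \<Rightarrow> 'a) \<Rightarrow> 'a mat" where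
  "bidiag_mat n m h g = block_mat n m (m + 1) (\<lambda>i j.
     (if j = i then - h else if j = i + 1 then g i else 0) \<cdot>\<^sub>m 1\<^sub>m n)"

text \<open>Solution of the recurrence expressed by the rows of the bidiagonal matrix, in
  homogeneous form: for i from 1 to m + 1 it has total degree m in \<open>h\<close> and the values
  of \<open>g\<close>. For \<open>h = 0\<close> and \<open>g = 1\<close> only the coefficient at i =
  1 survives, because \<open>0 ^ 0 = 1\<close>.\<close>

definition bidiag_coeff :: "nat \<Rightarrow> 'a::field \<Rightarrow> (nat \<Rightarrow> 'a) \<Rightarrow> nat \<Rightarrow> 'a" where
  "bidiag_coeff m h g i = h ^ (i - 1) * (\<Prod>l = i..m. g l)"

text \<open>The block column \<open>L\<close> of the proof idea. Its blocks are scalar multiples of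
  the identity, so its image of \<open>p\<close> has a multiple of \<open>p\<close> in every
  block.\<close>

definition bidiag_ker :: "nat \<Rightarrow> nat \<Rightarrow> 'a::field \<Rightarrow> (nat \<Rightarrow> 'a) \<Rightarrow> 'a mat" where
  "bidiag_ker n m h g = block_mat n (m + 1) 1 (\<lambda>i j. bidiag_coeff m h g i \<cdot>\<^sub>m 1\<^sub>m n)"

lemma bidiag_mat_carrier [simp]: "bidiag_mat n m h g \<in> carrier_mat (m * n) ((m + 1) * n)"
  unfolding bidiag_mat_def by (rule block_mat_carrier)

lemma bidiag_ker_carrier [simp]: "bidiag_ker n m h g \<in> carrier_mat ((m + 1) * n) n"
  using block_mat_carrier[of n "m + 1" 1] unfolding bidiag_ker_def by (metis mult_1)

lemma index_bidiag_ker: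
  assumes "i \<in> {1..m + 1}" "a < n" "b < n"
  shows "bidiag_ker n m h g $$ ((i - 1) * n + a, b) = (if a = b then bidiag_coeff m h g i else 0)"
proof -
  have "bidiag_ker n m h g $$ ((i - 1) * n + a, (1 - 1) * n + b) =
      (bidiag_coeff m h g i \<cdot>\<^sub>m 1\<^sub>m n) $$ (a, b)"
    unfolding bidiag_ker_def using assms by (subst block_mat_index) auto
  then show ?thesis using assms by simp
qed

lemma sum_if_delta:
  fixes f :: "nat \<Rightarrow> 'a::comm_monoid_add"
  assumes "a < n"
  shows "(\<Sum>b = 0..<n. if a = b then f b else 0) = f a"
    and "(\<Sum>b = 0..<n. if b = a then f b else 0) = f a"
  using assms by (simp_all add: sum.delta sum.delta')

text \<open>All blocks are scalar, so different positions \<open>a\<close> do not interact, and row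
  i meets only the blocks i and i + 1. Null vectors are thereby governed by a scalar recurrence for
  each \<open>a\<close>.\<close>

lemma bidiag_mat_mult_vec:
  assumes v: "v \<in> carrier_vec ((m + 1) * n)" and i: "i \<in> {1..m}" and a: "a < n"
  shows "(bidiag_mat n m h g *\<^sub>v v) $ ((i - 1) * n + a) =
    - h * v $ ((i - 1) * n + a) + g i * v $ (i * n + a)"
proof -
  have "(bidiag_mat n m h g *\<^sub>v v) $ ((i - 1) * n + a) =
    (\<Sum>j = 1..m + 1. \<Sum>b = 0..<n.
      bidiag_mat n m h g $$ ((i - 1) * n + a, (j - 1) * n + b) * v $ ((j - 1) * n + b))"
    by (rule mult_mat_vec_index_blocks[OF bidiag_mat_carrier v block_index_less[OF i a]])
  also have "\<dots> = (\<Sum>j = 1..m + 1. \<Sum>b = 0..<n. if a = b then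
      (if j = i then - h else if j = i + 1 then g i else 0) * v $ ((j - 1) * n + b) else 0)"
    using i a by (intro sum.cong refl) (simp add: bidiag_mat_def block_mat_index del: One_nat_def)
  also have "\<dots> = (\<Sum>j = 1..m + 1.
      (if j = i then - h * v $ ((j - 1) * n + a) else 0) +
      (if j = i + 1 then g i * v $ ((j - 1) * n + a) else 0))"
    unfolding sum_if_delta[OF a] by (intro sum.cong) auto
  also have "\<dots> = - h * v $ ((i - 1) * n + a) + g i * v $ (i * n + a)"
    using i unfolding sum.distrib by (simp add: sum.delta)
  finally show ?thesis .
qed

lemma transpose_bidiag_mat_mult_vec:
  assumes v: "v \<in> carrier_vec (m * n)" and i: "i \<in> {1..m + 1}" and a: "a < n"
  shows "((bidiag_mat n m h g)\<^sup>T *\<^sub>v v) $ ((i - 1) * n + a) =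
    (if i \<le> m then - h * v $ ((i - 1) * n + a) else 0) +
    (if i \<ge> 2 then g (i - 1) * v $ ((i - 2) * n + a) else 0)"
proof -
  have c: "(bidiag_mat n m h g)\<^sup>T \<in> carrier_mat ((m + 1) * n) (m * n)"
    unfolding transpose_carrier_mat by (rule bidiag_mat_carrier)
  have "((bidiag_mat n m h g)\<^sup>T *\<^sub>v v) $ ((i - 1) * n + a) =
    (\<Sum>j = 1..m. \<Sum>b = 0..<n.
      (bidiag_mat n m h g)\<^sup>T $$ ((i - 1) * n + a, (j - 1) * n + b) * v $ ((j - 1) * n + b))"
    by (rule mult_mat_vec_index_blocks[OF c v block_index_less[OF i a]])
  also have "\<dots> = (\<Sum>j = 1..m. \<Sum>b = 0..<n. if b = a then
      (if i = j then - h else if i = j + 1 then g j else 0) * v $ ((j - 1) * n + b) else 0)"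
    using i a unfolding bidiag_mat_def
    by (intro sum.cong refl, subst index_transpose_block_mat) auto
  \<comment> \<open>For i = 1 the truncated difference i - 1 is 0 and lies outside the range of j,
    so the second summand then vanishes as it should.\<close>
  also have "\<dots> = (\<Sum>j = 1..m.
      (if j = i then - h * v $ ((j - 1) * n + a) else 0) +
      (if j = i - 1 then g j * v $ ((j - 1) * n + a) else 0))"
    unfolding sum_if_delta[OF a] using i by (intro sum.cong) auto
  also have "\<dots> = (if i \<le> m then - h * v $ ((i - 1) * n + a) else 0) +
    (if i \<ge> 2 then g (i - 1) * v $ ((i - 2) * n + a) else 0)"
    using i unfolding sum.distrib by (auto simp: sum.delta numeral_2_eq_2)
  finally show ?thesis .
qed

lemma bidiag_ker_mult_vec:
  assumes p: "p \<in> carrier_vec n" and i: "i \<in> {1..m + 1}" and a: "a < n"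
  shows "(bidiag_ker n m h g *\<^sub>v p) $ ((i - 1) * n + a) = bidiag_coeff m h g i * p $ a"
proof -
  have "(bidiag_ker n m h g *\<^sub>v p) $ ((i - 1) * n + a) =
      (\<Sum>b = 0..<n. bidiag_ker n m h g $$ ((i - 1) * n + a, b) * p $ b)"
    using p block_index_less[OF i a] carrier_matD[OF bidiag_ker_carrier[of n m h g]]
    by (simp add: scalar_prod_def del: One_nat_def)
  also have "\<dots> = (\<Sum>b = 0..<n. if a = b then bidiag_coeff m h g i * p $ b else 0)"
    using i a by (intro sum.cong) (auto simp: index_bidiag_ker simp del: One_nat_def)
  also have "\<dots> = bidiag_coeff m h g i * p $ a"
    by (rule sum_if_delta(1)[OF a])
  finally show ?thesis .
qed

text \<open>Both sides are \<open>h ^ i\<close> times the product of the \<open>g l\<close> with l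
  from i to m. This cancellation is what annihilates the kernel block column.\<close>

lemma bidiag_coeff_step:
  assumes "i \<in> {1..m}"
  shows "h * bidiag_coeff m h g i = g i * bidiag_coeff m h g (i + 1)"
proof -
  have "h * h ^ (i - 1) = h ^ i" using assms by (cases i) auto
  moreover have "(\<Prod>l = i..m. g l) = g i * (\<Prod>l = i + 1..m. g l)"
    using assms by (subst prod.atLeast_Suc_atMost) auto
  ultimately show ?thesis
    by (simp add: bidiag_coeff_def)
qed

lemma bidiag_mat_mult_ker:
  fixes g :: "nat \<Rightarrow> 'a::field"
  shows "bidiag_mat n m h g * bidiag_ker n m h g = 0\<^sub>m (m * n) n"
proof (rule eq_matI)
  fix s t assume "s < dim_row (0\<^sub>m (m * n) n :: 'a mat)" "t < dim_col (0\<^sub>m (m * n) n :: 'a mat)"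
  then have s: "s < m * n" and t: "t < n" by auto
  from s obtain i a where i: "i \<in> {1..m}" and a: "a < n" and s_eq: "s = (i - 1) * n + a"
    by (rule block_indexE)
  \<comment> \<open>Columns are images of unit vectors, so the formulas for matrix-vector products
    apply to the product of the two matrices.\<close>
  have col: "col (bidiag_ker n m h g) t = bidiag_ker n m h g *\<^sub>v unit_vec n t"
    using t carrier_matD[OF bidiag_ker_carrier[of n m h g]] by (intro eq_vecI) simp_all
  have u: "unit_vec n t \<in> carrier_vec n" by simp
  have "(bidiag_mat n m h g * bidiag_ker n m h g) $$ (s, t) =
      (bidiag_mat n m h g *\<^sub>v col (bidiag_ker n m h g) t) $ s"
    using s t carrier_matD[OF bidiag_mat_carrier[of n m h g]]
      carrier_matD[OF bidiag_ker_carrier[of n m h g]] by simp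
  also have "\<dots> = - h * (bidiag_ker n m h g *\<^sub>v unit_vec n t) $ ((i - 1) * n + a)
      + g i * (bidiag_ker n m h g *\<^sub>v unit_vec n t) $ (i * n + a)"
    unfolding s_eq col
    by (rule bidiag_mat_mult_vec[OF mult_mat_vec_carrier[OF bidiag_ker_carrier u] i a])
  also have "\<dots> = 0"
    using bidiag_ker_mult_vec[OF u _ a, of i m h g] bidiag_ker_mult_vec[OF u _ a, of "i + 1" m h g]
      bidiag_coeff_step[OF i, of h g] i by (simp add: algebra_simps) 
  finally show "(bidiag_mat n m h g * bidiag_ker n m h g) $$ (s, t) = 0\<^sub>m (m * n) n $$ (s, t)"
    using s t by simp
qed (simp_all add: carrier_matD[OF bidiag_mat_carrier] carrier_matD[OF bidiag_ker_carrier])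


text \<open>Row l reads h u(l) = g(l) u(l+1). For \<open>h = 1\<close> every block is determined by
  the next one, hence all of them by the last; no \<open>g l\<close> has to be inverted, so nodes
  are allowed as eigenvalues. For \<open>h = 0\<close> and \<open>g = 1\<close> all blocks after the
  first vanish, and the first one is free.\<close>

lemma bidiag_mat_null_vec:
  assumes u: "u \<in> carrier_vec ((m + 1) * n)" and null: "bidiag_mat n m h g *\<^sub>v u = 0\<^sub>v (m * n)"
    and hg: "h = 1 \<or> h = 0 \<and> (\<forall>i. g i = 1)"
  shows "u = bidiag_ker n m h g *\<^sub>v block_vec n u (if h = 1 then m + 1 else 1)"
proof (rule block_vec_eqI[OF u mult_mat_vec_carrier[OF bidiag_ker_carrier block_vec_carrier]])
  fix i a assume i: "i \<in> {1..m + 1}" and a: "a < n"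
  have rec: "h * u $ ((l - 1) * n + a) = g l * u $ (l * n + a)" if l: "l \<in> {1..m}" for l
    using bidiag_mat_mult_vec[OF u l a, of h g] block_index_less[OF l a] null
    by (simp add: algebra_simps)
  have "u $ ((i - 1) * n + a) =
      bidiag_coeff m h g i * u $ (((if h = 1 then m + 1 else 1) - 1) * n + a)"
  proof (cases "h = 1")
    case True
    have "i \<le> m + 1" "1 \<le> i" using i by auto
    then have "u $ ((i - 1) * n + a) = bidiag_coeff m h g i * u $ (m * n + a)"
    \<comment> \<open>Downward induction from the free block m + 1.\<close>
    proof (induction rule: inc_induct)
      case base
      show ?case using True by (simp add: bidiag_coeff_def)
    next
      case (step l)
      then have l: "l \<in> {1..m}" by auto
      have "u $ ((l - 1) * n + a) = g l * u $ (l * n + a)"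
        using rec[OF l] True by simp
      also have "\<dots> = g l * bidiag_coeff m h g (l + 1) * u $ (m * n + a)"
        using step by simp
      finally show ?case
        using bidiag_coeff_step[OF l, of h g] True by simp
    qed
    then show ?thesis using True by simp
  next
    case False
    then have hg: "h = 0" "g = (\<lambda>_. 1)" using hg by auto
    show ?thesis
    proof (cases "i = 1")
      case True
      then show ?thesis using hg by (simp add: bidiag_coeff_def)
    next
      case False
      then have "i - 1 \<in> {1..m}" "bidiag_coeff m h g i = 0"
        using i hg by (auto simp: bidiag_coeff_def)
      \<comment> \<open>At infinity row i - 1 says exactly that block i is zero.\<close>
      then show ?thesis using rec[of "i - 1"] hg by simp
    qed
  qed
  then show "u $ ((i - 1) * n + a) = (bidiag_ker n m h g *\<^sub>v
      block_vec n u (if h = 1 then m + 1 else 1)) $ ((i - 1) * n + a)"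
    by (simp only: bidiag_ker_mult_vec[OF block_vec_carrier i a] index_block_vec[OF a])
qed

text \<open>For \<open>h = 1\<close> the first row gives w(1) = 0, and each later row passes this on
  to the next block. For \<open>h = 0\<close> and \<open>g = 1\<close> row i + 1 is w(i) = 0
  directly.\<close>

lemma transpose_bidiag_mat_null_vec:
  assumes w: "w \<in> carrier_vec (m * n)"
    and null: "(bidiag_mat n m h g)\<^sup>T *\<^sub>v w = 0\<^sub>v ((m + 1) * n)"
    and hg: "h = 1 \<or> h = 0 \<and> (\<forall>i. g i = 1)"
  shows "w = 0\<^sub>v (m * n)"
proof (rule block_vec_eqI[OF w zero_carrier_vec])
  fix i a assume i: "i \<in> {1..m}" and a: "a < n"
  have rec: "(if l \<le> m then - h * w $ ((l - 1) * n + a) else 0) +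
      (if l \<ge> 2 then g (l - 1) * w $ ((l - 2) * n + a) else 0) = 0" if l: "l \<in> {1..m + 1}" for l
    using transpose_bidiag_mat_mult_vec[OF w l a, of h g] block_index_less[OF l a] null
    by (simp del: One_nat_def)
  have "w $ ((i - 1) * n + a) = 0"
  proof (cases "h = 1")
    case True
    have "1 \<le> i" "i \<le> m" using i by auto
    then show ?thesis
    proof (induction rule: dec_induct)
      case base
      then show ?case using rec[of 1] True by simp
    next
      case (step l)
      then show ?case using rec[of "l + 1"] True by simp
    qed
  next
    case False
    then show ?thesis using rec[of "i + 1"] i hg by (auto split: if_splits)
  qed
  then show "w $ ((i - 1) * n + a) = 0\<^sub>v (m * n) $ ((i - 1) * n + a)"
    using block_index_less[OF i a] by simp
qed

section \<open>Null vectors of block Kronecker matrices\<close>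

lemma mult_mat_zero_vec:
  fixes A :: "'a::semiring_0 mat"
  assumes "A \<in> carrier_mat nr nc"
  shows "A *\<^sub>v 0\<^sub>v nc = 0\<^sub>v nr"
  using assms by (intro eq_vecI) auto

text \<open>Formulated for abstract matrices of independent sizes so that the pencil and its
  transpose are both instances. The function \<open>p\<close> reads off, from a null vector of
  \<open>K\<^sub>1\<close>, its coordinates with respect to \<open>L\<^sub>1\<close>; later it
  extracts one block.\<close>

lemma block_kronecker_null_vec:
  fixes M :: "'a::field mat"
  assumes M: "M \<in> carrier_mat c\<^sub>2 c\<^sub>1" and A: "A \<in> carrier_mat c\<^sub>2 r\<^sub>1"
    and B: "B \<in> carrier_mat r\<^sub>2 c\<^sub>1" and K1: "K\<^sub>1 \<in> carrier_mat r\<^sub>1 c\<^sub>1"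
    and K2: "K\<^sub>2 \<in> carrier_mat r\<^sub>2 c\<^sub>2" and L1: "L\<^sub>1 \<in> carrier_mat c\<^sub>1 n"
    and L2: "L\<^sub>2 \<in> carrier_mat c\<^sub>2 n" and KL: "K\<^sub>2 * L\<^sub>2 = 0\<^sub>m r\<^sub>2 n"
    and inj: "\<And>w. w \<in> carrier_vec r\<^sub>2 \<Longrightarrow> K\<^sub>2\<^sup>T *\<^sub>v w = 0\<^sub>v c\<^sub>2 \<Longrightarrow> w = 0\<^sub>v r\<^sub>2"
    and p: "\<And>u. p u \<in> carrier_vec n"
    and ker: "\<And>u. u \<in> carrier_vec c\<^sub>1 \<Longrightarrow> K\<^sub>1 *\<^sub>v u = 0\<^sub>v r\<^sub>1 \<Longrightarrow> u = L\<^sub>1 *\<^sub>v p u"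
    and z: "z \<in> carrier_vec (c\<^sub>1 + r\<^sub>2)" "z \<noteq> 0\<^sub>v (c\<^sub>1 + r\<^sub>2)"
    and Nz: "four_block_mat (M + A * K\<^sub>1 + K\<^sub>2\<^sup>T * B) K\<^sub>2\<^sup>T K\<^sub>1 (0\<^sub>m r\<^sub>1 r\<^sub>2) *\<^sub>v z = 0\<^sub>v (c\<^sub>2 + r\<^sub>1)"
  shows "vec_first z c\<^sub>1 = L\<^sub>1 *\<^sub>v p (vec_first z c\<^sub>1)"
    and "(L\<^sub>2\<^sup>T * M * L\<^sub>1) *\<^sub>v p (vec_first z c\<^sub>1) = 0\<^sub>v n"
    and "p (vec_first z c\<^sub>1) \<noteq> 0\<^sub>v n"
proof -
  define u w where "u = vec_first z c\<^sub>1" and "w = vec_last z r\<^sub>2"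
  have u: "u \<in> carrier_vec c\<^sub>1" and w: "w \<in> carrier_vec r\<^sub>2"
    by (simp_all add: u_def w_def)
  have z_eq: "z = u @\<^sub>v w" using z by (simp add: u_def w_def)
  have K2T: "K\<^sub>2\<^sup>T \<in> carrier_mat c\<^sub>2 r\<^sub>2" and L2T: "L\<^sub>2\<^sup>T \<in> carrier_mat n c\<^sub>2"
    using K2 L2 by auto
  have TL: "M + A * K\<^sub>1 + K\<^sub>2\<^sup>T * B \<in> carrier_mat c\<^sub>2 c\<^sub>1" using M A B K1 K2T by auto
  have zero_append: "(0\<^sub>v (c\<^sub>2 + r\<^sub>1) :: 'a vec) = 0\<^sub>v c\<^sub>2 @\<^sub>v 0\<^sub>v r\<^sub>1" by auto
  have "((M + A * K\<^sub>1 + K\<^sub>2\<^sup>T * B) *\<^sub>v u + K\<^sub>2\<^sup>T *\<^sub>v w) @\<^sub>v (K\<^sub>1 *\<^sub>v u + 0\<^sub>m r\<^sub>1 r\<^sub>2 *\<^sub>v w)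
      = 0\<^sub>v c\<^sub>2 @\<^sub>v 0\<^sub>v r\<^sub>1"
    using Nz unfolding z_eq zero_append
    by (subst (asm) four_block_mat_mult_vec[OF TL K2T K1 zero_carrier_mat u w])
  then have "(M + A * K\<^sub>1 + K\<^sub>2\<^sup>T * B) *\<^sub>v u + K\<^sub>2\<^sup>T *\<^sub>v w = 0\<^sub>v c\<^sub>2 \<and> K\<^sub>1 *\<^sub>v u + 0\<^sub>m r\<^sub>1 r\<^sub>2 *\<^sub>v w = 0\<^sub>v r\<^sub>1"
    using TL K2T u w by (subst (asm) append_vec_eq[of _ c\<^sub>2]) auto
  moreover have "0\<^sub>m r\<^sub>1 r\<^sub>2 *\<^sub>v w = 0\<^sub>v r\<^sub>1" using w by (intro eq_vecI) auto
  ultimately have top: "(M + A * K\<^sub>1 + K\<^sub>2\<^sup>T * B) *\<^sub>v u + K\<^sub>2\<^sup>T *\<^sub>v w = 0\<^sub>v c\<^sub>2"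
    and K1u: "K\<^sub>1 *\<^sub>v u = 0\<^sub>v r\<^sub>1"
    using K1 u by auto
  have Bu: "B *\<^sub>v u \<in> carrier_vec r\<^sub>2" and Mu: "M *\<^sub>v u \<in> carrier_vec c\<^sub>2"
    using B M u by auto
  have "(M + A * K\<^sub>1 + K\<^sub>2\<^sup>T * B) *\<^sub>v u = M *\<^sub>v u + A *\<^sub>v (K\<^sub>1 *\<^sub>v u) + K\<^sub>2\<^sup>T *\<^sub>v (B *\<^sub>v u)"
    using M A B K1 K2T u by (simp add: add_mult_distrib_mat_vec[of _ c\<^sub>2 c\<^sub>1] assoc_add_vec[of _ c\<^sub>2])
  also have "\<dots> = M *\<^sub>v u + K\<^sub>2\<^sup>T *\<^sub>v (B *\<^sub>v u)" using K1u mult_mat_zero_vec[OF A] Mu by simp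
  finally have top': "(M + A * K\<^sub>1 + K\<^sub>2\<^sup>T * B) *\<^sub>v u = M *\<^sub>v u + K\<^sub>2\<^sup>T *\<^sub>v (B *\<^sub>v u)" .
  \<comment> \<open>The contribution of \<open>B\<close> and the lower part \<open>w\<close> are
    both behind the factor \<open>K\<^sub>2\<^sup>T\<close>, so a single multiplication by
    \<open>L\<^sub>2\<^sup>T\<close> removes them together.\<close>
  have "M *\<^sub>v u + K\<^sub>2\<^sup>T *\<^sub>v (B *\<^sub>v u + w) = 0\<^sub>v c\<^sub>2"
    using top unfolding top' using K2T Bu Mu w
    by (simp add: mult_add_distrib_mat_vec[of _ c\<^sub>2 r\<^sub>2] assoc_add_vec[of _ c\<^sub>2])
  then have "L\<^sub>2\<^sup>T *\<^sub>v (M *\<^sub>v u + K\<^sub>2\<^sup>T *\<^sub>v (B *\<^sub>v u + w)) = 0\<^sub>v n"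
    by (simp only: mult_mat_zero_vec[OF L2T])
  moreover have "L\<^sub>2\<^sup>T *\<^sub>v (M *\<^sub>v u + K\<^sub>2\<^sup>T *\<^sub>v (B *\<^sub>v u + w)) =
      L\<^sub>2\<^sup>T *\<^sub>v (M *\<^sub>v u) + (L\<^sub>2\<^sup>T * K\<^sub>2\<^sup>T) *\<^sub>v (B *\<^sub>v u + w)"
    using L2T K2T Mu Bu w by (simp add: mult_add_distrib_mat_vec[of _ n c\<^sub>2])
  moreover have "L\<^sub>2\<^sup>T * K\<^sub>2\<^sup>T = 0\<^sub>m n r\<^sub>2"
    using transpose_mult[OF K2 L2] KL by simp
  moreover have "0\<^sub>m n r\<^sub>2 *\<^sub>v (B *\<^sub>v u + w) = 0\<^sub>v n"
    using Bu w by (intro eq_vecI) auto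
  ultimately have L2Mu: "L\<^sub>2\<^sup>T *\<^sub>v (M *\<^sub>v u) = 0\<^sub>v n" using L2T Mu by simp
  have u_eq: "u = L\<^sub>1 *\<^sub>v p u" by (rule ker[OF u K1u])
  then show "vec_first z c\<^sub>1 = L\<^sub>1 *\<^sub>v p (vec_first z c\<^sub>1)" by (simp add: u_def)
  have "(L\<^sub>2\<^sup>T * M * L\<^sub>1) *\<^sub>v p u = L\<^sub>2\<^sup>T *\<^sub>v (M *\<^sub>v (L\<^sub>1 *\<^sub>v p u))"
    by (simp only: assoc_mult_mat_vec[OF mult_carrier_mat[OF L2T M] L1 p]
        assoc_mult_mat_vec[OF L2T M mult_mat_vec_carrier[OF L1 p]])
  then show "(L\<^sub>2\<^sup>T * M * L\<^sub>1) *\<^sub>v p (vec_first z c\<^sub>1) = 0\<^sub>v n"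
    by (simp only: u_eq[symmetric] L2Mu u_def[symmetric])
  show "p (vec_first z c\<^sub>1) \<noteq> 0\<^sub>v n"
  proof
    assume "p (vec_first z c\<^sub>1) = 0\<^sub>v n"
    then have "u = L\<^sub>1 *\<^sub>v 0\<^sub>v n" by (subst u_eq) (simp only: u_def)
    then have u0: "u = 0\<^sub>v c\<^sub>1" by (simp only: mult_mat_zero_vec[OF L1])
    have "K\<^sub>2\<^sup>T *\<^sub>v w = 0\<^sub>v c\<^sub>2" 
      using top K2T w unfolding u0 mult_mat_zero_vec[OF TL] by simp
    then have "w = 0\<^sub>v r\<^sub>2" by (rule inj[OF w])
    then have "z = 0\<^sub>v (c\<^sub>1 + r\<^sub>2)" unfolding z_eq u0 by auto
    then show False using z(2) by simp
  qed
qed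

text \<open>Here \<open>j\<^sub>0\<close> is the block of \<open>z\<close> that parametrises the
  null space of the bidiagonal matrix: the last block of the upper part when \<open>h = 1\<close>,
  the first at infinity. The third conclusion later carries the eigenvector property from this block
  to the others.\<close>

lemma bidiag_kronecker_null_vec:
  fixes M :: "'a::field mat"
  assumes M: "M \<in> carrier_mat ((m\<^sub>2 + 1) * n) ((m\<^sub>1 + 1) * n)"
    and A: "A \<in> carrier_mat ((m\<^sub>2 + 1) * n) (m\<^sub>1 * n)"
    and B: "B \<in> carrier_mat (m\<^sub>2 * n) ((m\<^sub>1 + 1) * n)"
    and hg: "h = 1 \<or> h = 0 \<and> (\<forall>i. g\<^sub>1 i = 1) \<and> (\<forall>i. g\<^sub>2 i = 1)"
    and j0: "j\<^sub>0 = (if h = 1 then m\<^sub>1 + 1 else 1)"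
    and z: "z \<in> carrier_vec ((m\<^sub>1 + 1) * n + m\<^sub>2 * n)" "z \<noteq> 0\<^sub>v ((m\<^sub>1 + 1) * n + m\<^sub>2 * n)"
    and Nz: "four_block_mat (M + A * bidiag_mat n m\<^sub>1 h g\<^sub>1 + (bidiag_mat n m\<^sub>2 h g\<^sub>2)\<^sup>T * B)
      (bidiag_mat n m\<^sub>2 h g\<^sub>2)\<^sup>T (bidiag_mat n m\<^sub>1 h g\<^sub>1) (0\<^sub>m (m\<^sub>1 * n) (m\<^sub>2 * n)) *\<^sub>v z =
      0\<^sub>v ((m\<^sub>2 + 1) * n + m\<^sub>1 * n)"
  shows "((bidiag_ker n m\<^sub>2 h g\<^sub>2)\<^sup>T * M * bidiag_ker n m\<^sub>1 h g\<^sub>1) *\<^sub>v block_vec n z j\<^sub>0 = 0\<^sub>v n"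
    and "block_vec n z j\<^sub>0 \<noteq> 0\<^sub>v n"
    and "\<And>i. i \<in> {1..m\<^sub>1 + 1} \<Longrightarrow> block_vec n z i = bidiag_coeff m\<^sub>1 h g\<^sub>1 i \<cdot>\<^sub>v block_vec n z j\<^sub>0"
proof -
  let ?u = "vec_first z ((m\<^sub>1 + 1) * n)"
  have block_u: "block_vec n ?u i = block_vec n z i" if "i \<in> {1..m\<^sub>1 + 1}" for i
  proof (rule eq_vecI)
    fix a assume "a < dim_vec (block_vec n z i)"
    then have "a < n" by (simp add: block_vec_def)
    then show "block_vec n ?u i $ a = block_vec n z i $ a"
      using block_index_less[OF that] by (simp add: vec_first_def del: One_nat_def mult_Suc)
  qed (simp add: block_vec_def)
  have j0_mem: "j\<^sub>0 \<in> {1..m\<^sub>1 + 1}" by (simp add: j0)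
  have inj: "w = 0\<^sub>v (m\<^sub>2 * n)"
    if "w \<in> carrier_vec (m\<^sub>2 * n)" "(bidiag_mat n m\<^sub>2 h g\<^sub>2)\<^sup>T *\<^sub>v w = 0\<^sub>v ((m\<^sub>2 + 1) * n)" for w
    using transpose_bidiag_mat_null_vec[OF that] hg by blast
  have ker: "u = bidiag_ker n m\<^sub>1 h g\<^sub>1 *\<^sub>v block_vec n u j\<^sub>0"
    if "u \<in> carrier_vec ((m\<^sub>1 + 1) * n)" "bidiag_mat n m\<^sub>1 h g\<^sub>1 *\<^sub>v u = 0\<^sub>v (m\<^sub>1 * n)" for u
    unfolding j0 by (rule bidiag_mat_null_vec[OF that]) (use hg in blast)
  note null = block_kronecker_null_vec[OF M A B bidiag_mat_carrier bidiag_mat_carrier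
      bidiag_ker_carrier bidiag_ker_carrier bidiag_mat_mult_ker inj block_vec_carrier ker z Nz]
  show "((bidiag_ker n m\<^sub>2 h g\<^sub>2)\<^sup>T * M * bidiag_ker n m\<^sub>1 h g\<^sub>1) *\<^sub>v block_vec n z j\<^sub>0 = 0\<^sub>v n"
    using null(2) unfolding block_u[OF j0_mem] .
  show "block_vec n z j\<^sub>0 \<noteq> 0\<^sub>v n"
    using null(3) unfolding block_u[OF j0_mem] .
  have u_eq: "?u = bidiag_ker n m\<^sub>1 h g\<^sub>1 *\<^sub>v block_vec n ?u j\<^sub>0"
    by (rule null(1))
  fix i assume i: "i \<in> {1..m\<^sub>1 + 1}"
  show "block_vec n z i = bidiag_coeff m\<^sub>1 h g\<^sub>1 i \<cdot>\<^sub>v block_vec n z j\<^sub>0"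
  proof (rule eq_vecI)
    fix a assume "a < dim_vec (bidiag_coeff m\<^sub>1 h g\<^sub>1 i \<cdot>\<^sub>v block_vec n z j\<^sub>0)"
    then have a: "a < n" by (simp add: block_vec_def)
    have "block_vec n z i $ a = ?u $ ((i - 1) * n + a)"
      unfolding block_u[OF i, symmetric] by (rule index_block_vec[OF a])
    also have "\<dots> = bidiag_coeff m\<^sub>1 h g\<^sub>1 i * block_vec n z j\<^sub>0 $ a"
      unfolding block_u[OF j0_mem, symmetric]
      by (subst u_eq) (rule bidiag_ker_mult_vec[OF block_vec_carrier i a])
    finally show "block_vec n z i $ a = (bidiag_coeff m\<^sub>1 h g\<^sub>1 i \<cdot>\<^sub>v block_vec n z j\<^sub>0) $ a"
      using a by (simp add: block_vec_def)
  qed (simp add: block_vec_def)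
qed

section \<open>Evaluation of Newton pencils\<close>

text \<open>Value of an entry of a pencil: the reversal of grade 1, taken at 0, is the coefficient
  of degree 1. The map is linear in both cases, but at infinity it is not multiplicative.\<close>

fun lin_at :: "eigval \<Rightarrow> complex poly \<Rightarrow> complex" where
  "lin_at (Fin c) p = poly p c"
| "lin_at Infty p = coeff p 1"

text \<open>
  Finite and infinite eigenvalues are treated together through the homogeneous values
  \<open>h\<close> of \<open>1\<close> and \<open>g j\<close> of \<open>\<gamma>\<^sub>j\<close>: they are \<open>(1, c - x\<^sub>j)\<close> at a finite \<open>c\<close> and \<open>(0, 1)\<close> at infinity.
\<close>

definition newton_h :: "eigval \<Rightarrow> complex" where
  "newton_h e = lin_at e 1"

definition newton_g :: "(nat \<Rightarrow> complex) \<Rightarrow> eigval \<Rightarrow> nat \<Rightarrow> complex" where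
  "newton_g x e j = lin_at e (newton_gamma x j)"

lemma newton_h_simps [simp]: "newton_h (Fin c) = 1" "newton_h Infty = 0"
  by (simp_all add: newton_h_def)

lemma newton_g_simps [simp]: "newton_g x (Fin c) j = c - x j" "newton_g x Infty j = 1"
  by (simp_all add: newton_g_def newton_gamma_def)

lemma lin_at_0 [simp]: "lin_at e 0 = 0"
  by (cases e) simp_all

lemma lin_at_add: "lin_at e (p + q) = lin_at e p + lin_at e q"
  by (cases e) simp_all

lemma lin_at_minus: "lin_at e (- p) = - lin_at e p"
  by (cases e) simp_all

lemma lin_at_smult: "lin_at e (smult a p) = a * lin_at e p"
  by (cases e) simp_all

text \<open>A constant in a pencil of grade 1 is homogenised to a multiple of \<open>h\<close>, so
  constants disappear at infinity.\<close>

lemma lin_at_const: "lin_at e [:a:] = newton_h e * a"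
  using lin_at_smult[of e a 1] by (simp add: newton_h_def one_pCons mult.commute)

lemma lin_at_sum: "lin_at e (sum f S) = (\<Sum>i\<in>S. lin_at e (f i))"
  by (induction S rule: infinite_finite_induct) (simp_all add: lin_at_add)

lemma poly_rev_grade_0: "poly (rev_grade k p) 0 = coeff p k"
proof -
  have "poly (rev_grade k p) 0 = (\<Sum>i\<le>k. if i = 0 then coeff p k else 0)"
    unfolding rev_grade_def poly_sum by (intro sum.cong) (auto simp: poly_monom)
  then show ?thesis by simp
qed

lemma mat_at_eigval_1: "mat_at_eigval 1 X e = map_mat (lin_at e) X"
  by (cases e) (auto intro!: eq_matI
      simp: poly_mat_at_def rev_poly_mat_def poly_rev_grade_0 simp del: One_nat_def)

text \<open>Linearity suffices because one factor is constant; the products in the pencil are those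
  with \<open>A\<close> and \<open>B\<close> only.\<close>

lemma map_lin_at_const_mult:
  assumes "C \<in> carrier_mat nr m" "K \<in> carrier_mat m nc"
  shows "map_mat (lin_at e) (const_poly_mat C * K) = C * map_mat (lin_at e) K"
  using assms
  by (intro eq_matI) (auto simp: const_poly_mat_def scalar_prod_def lin_at_sum lin_at_smult)

lemma map_lin_at_mult_const:
  assumes "K \<in> carrier_mat nr m" "C \<in> carrier_mat m nc"
  shows "map_mat (lin_at e) (K * const_poly_mat C) = map_mat (lin_at e) K * C"
  using assms
  by (intro eq_matI)
    (auto simp: const_poly_mat_def scalar_prod_def lin_at_sum lin_at_smult mult.commute)

lemma map_lin_at_add:
  assumes "A \<in> carrier_mat nr nc" "B \<in> carrier_mat nr nc"
  shows "map_mat (lin_at e) (A + B) = map_mat (lin_at e) A + map_mat (lin_at e) B"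
  using assms by (intro eq_matI) (auto simp: lin_at_add)

text \<open>The index map \<open>r\<close> is kept general because the two matrices
  \<open>K\<^sub>1\<close> and \<open>K\<^sub>2\<close> run backwards through different ranges of
  nodes.\<close>

lemma map_lin_at_bidiag:
  "map_mat (lin_at e) (block_mat n m (m + 1) (\<lambda>i j. if j = i then - 1\<^sub>m n
     else if j = i + 1 then newton_gamma x (r i) \<cdot>\<^sub>m 1\<^sub>m n else 0\<^sub>m n n)) =
   bidiag_mat n m (newton_h e) (\<lambda>i. newton_g x e (r i))"
proof (rule block_mat_eqI)
  fix i j a b assume ij: "i \<in> {1..m}" "j \<in> {1..m + 1}" and ab: "a < n" "b < n"
  note less = block_index_less[OF ij(1) ab(1)] block_index_less[OF ij(2) ab(2)]
  show "map_mat (lin_at e) (block_mat n m (m + 1) (\<lambda>i j. if j = i then - 1\<^sub>m n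
     else if j = i + 1 then newton_gamma x (r i) \<cdot>\<^sub>m 1\<^sub>m n else 0\<^sub>m n n))
       $$ ((i - 1) * n + a, (j - 1) * n + b) =
     bidiag_mat n m (newton_h e) (\<lambda>i. newton_g x e (r i)) $$ ((i - 1) * n + a, (j - 1) * n + b)"
    unfolding bidiag_mat_def index_map_mat(1)[of _ "block_mat n r c F" for r c F, unfolded dim_block_mat, OF less]
      block_mat_index[OF ij ab]
    using ab by (auto simp: newton_h_def newton_g_def lin_at_minus)
qed (simp_all only: map_carrier_mat block_mat_carrier bidiag_mat_carrier)

lemma map_lin_at_newton_K1:
  assumes "k = m + \<mu> + 1"
  shows "map_mat (lin_at e) (newton_K1 n k \<mu> x) =
    bidiag_mat n m (newton_h e) (\<lambda>i. newton_g x e (k - i))"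
proof -
  have "k - \<mu> - 1 = m" "k - \<mu> = m + 1" using assms by simp_all
  then show ?thesis
    unfolding newton_K1_def by (simp only: map_lin_at_bidiag)
qed

lemma map_lin_at_newton_K2:
  "map_mat (lin_at e) (newton_K2 n \<mu> x) =
    bidiag_mat n \<mu> (newton_h e) (\<lambda>i. newton_g x e (\<mu> + 1 - i))"
  unfolding newton_K2_def by (rule map_lin_at_bidiag)

text \<open>Written as a sum instead of a case distinction so that the later double sum splits into
  three. The condition \<open>i \<noteq> 1\<close> keeps the block shared by the first row and the
  last column from being counted twice.\<close>

lemma lin_at_newton_M_index:
  assumes ij: "i \<in> {1..\<mu> + 1}" "j \<in> {1..k - \<mu>}" and ab: "a < n" "b < n"
    and P: "\<And>i. i \<le> k \<Longrightarrow> P i \<in> carrier_mat n n"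
  shows "map_mat (lin_at e) (newton_M n k \<mu> x P) $$ ((i - 1) * n + a, (j - 1) * n + b) =
    (if i = 1 \<and> j = 1 then newton_g x e k * P k $$ (a, b) else 0) +
    (if i = 1 then newton_h e * P (k - j) $$ (a, b) else 0) +
    (if j = k - \<mu> \<and> i \<noteq> 1 then newton_h e * P (\<mu> + 1 - i) $$ (a, b) else 0)"
proof -
  note less = block_index_less[OF ij(1) ab(1)] block_index_less[OF ij(2) ab(2)]
  have "P k \<in> carrier_mat n n" "P (k - j) \<in> carrier_mat n n" "P (k - 1) \<in> carrier_mat n n"
    "P (\<mu> + 1 - i) \<in> carrier_mat n n"
    using ij by (auto intro!: P)
  then show ?thesis
    unfolding newton_M_def index_map_mat(1)[of _ "block_mat n r c F" for r c F, unfolded dim_block_mat, OF less]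
      block_mat_index[OF ij ab]
    using ab by (auto simp: const_poly_mat_def lin_at_add lin_at_const lin_at_smult newton_g_def
        mult.commute[of "newton_gamma x k"])
qed

section \<open>The value of \<open>P\<close> in the Newton basis and the compression of
  \<open>M\<close>\<close>

lemma degree_newton_poly: "degree (newton_poly x i) = i"
  and lead_coeff_newton_poly: "lead_coeff (newton_poly x i) = 1"
proof -
  have "degree (newton_poly x i) = (\<Sum>l = 1..i. degree (newton_gamma x l))"
    unfolding newton_poly_def by (rule degree_prod_eq_sum_degree) (simp add: newton_gamma_def)
  then show "degree (newton_poly x i) = i" by (simp add: newton_gamma_def)
  show "lead_coeff (newton_poly x i) = 1"
    unfolding newton_poly_def lead_coeff_prod by (simp add: newton_gamma_def)
qed

text \<open>The basis polynomial of degree i is homogenised to the grade k, which supplies the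
  factor \<open>h ^ (k - i)\<close>.\<close>

lemma mat_at_eigval_newton_index:
  assumes "a < n" "b < n"
  shows "mat_at_eigval k (newton_poly_mat n k x P) e $$ (a, b) =
    (\<Sum>i = 0..k. P i $$ (a, b) * (newton_h e ^ (k - i) * (\<Prod>l = 1..i. newton_g x e l)))"
proof (cases e)
  case (Fin c)
  then show ?thesis
    using assms by (simp add: poly_mat_at_def newton_poly_mat_def newton_poly_def poly_sum poly_prod
        newton_gamma_def)
next
  case Infty
  \<comment> \<open>The Newton polynomials are monic with degree equal to the index, so only i = k
    reaches the coefficient of degree k; \<open>0 ^ (k - i)\<close> encodes this.\<close>
  have c: "coeff (newton_poly x i) k = 0 ^ (k - i)" if "i \<le> k" for i
    using that degree_newton_poly[of x i] lead_coeff_newton_poly[of x i]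
    by (cases "i = k") (auto simp: coeff_eq_0)
  have "mat_at_eigval k (newton_poly_mat n k x P) e $$ (a, b) =
      (\<Sum>i = 0..k. P i $$ (a, b) * coeff (newton_poly x i) k)"
    using assms Infty by (simp add: poly_mat_at_def rev_poly_mat_def newton_poly_mat_def
        poly_rev_grade_0 coeff_sum)
  then show ?thesis using Infty c by simp
qed

lemma newton_poly_mat_carrier: "newton_poly_mat n k x P \<in> carrier_mat n n"
  by (simp add: newton_poly_mat_def)

lemma mat_at_eigval_carrier:
  "X \<in> carrier_mat nr nc \<Longrightarrow> mat_at_eigval k X e \<in> carrier_mat nr nc"
  by (cases e) (simp_all add: poly_mat_at_def rev_poly_mat_def)

text \<open>The substitution of d + m + 1 - l for l undoes the backward numbering of the nodes. It
  is used with d = \<mu> for \<open>K\<^sub>1\<close> and with d = 0 for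
  \<open>K\<^sub>2\<close>.\<close>

lemma bidiag_coeff_reversed:
  assumes "1 \<le> i"
  shows "bidiag_coeff m h (\<lambda>l. G (d + m + 1 - l)) i = h ^ (i - 1) * (\<Prod>l = d + 1..d + m + 1 - i. G l)"
proof -
  have "(\<Prod>l = i..m. G (d + m + 1 - l)) = (\<Prod>l = d + 1..d + m + 1 - i. G l)"
    by (rule prod.reindex_bij_witness[where i = "\<lambda>l. d + m + 1 - l" and j = "\<lambda>l. d + m + 1 - l"])
      (use assms in auto)
  then show ?thesis by (simp add: bidiag_coeff_def)
qed

text \<open>Scalar core of the compression. The first block row of \<open>M\<close> produces the
  terms with index at least \<mu>, the rest of its last column those below \<mu>. Each entry of
  \<open>M\<close> adds one factor, \<open>h\<close> or \<open>G k\<close>, so every term reaches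
  total degree k.\<close>

lemma newton_sum_identity:
  fixes m \<mu> k :: nat and h :: "'a::field" and G p :: "nat \<Rightarrow> 'a"
  assumes k: "k = m + \<mu> + 1"
  defines "s \<equiv> bidiag_coeff m h (\<lambda>l. G (k - l))"
    and "t \<equiv> bidiag_coeff \<mu> h (\<lambda>l. G (\<mu> + 1 - l))"
  shows "(\<Sum>j = 1..m + 1. (\<Sum>i = 1..\<mu> + 1. t i *
      ((if i = 1 \<and> j = 1 then G k * p k else 0) + (if i = 1 then h * p (k - j) else 0) +
       (if j = m + 1 \<and> i \<noteq> 1 then h * p (\<mu> + 1 - i) else 0))) * s j) =
    (\<Sum>i = 0..k. p i * (h ^ (k - i) * (\<Prod>l = 1..i. G l)))" (is "?L = ?R")
proof -
  \<comment> \<open>The value of the Newton polynomial with index i; no block size occurs in this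
    lemma.\<close>
  define n where "n i = (\<Prod>l = 1..i. G l)" for i
  have s: "s j = h ^ (j - 1) * (\<Prod>l = \<mu> + 1..k - j. G l)" if "1 \<le> j" for j
    using bidiag_coeff_reversed[OF that, of m h G \<mu>] by (simp add: s_def k add_ac)
  have t: "t i = h ^ (i - 1) * n (\<mu> + 1 - i)" if "1 \<le> i" for i
    using bidiag_coeff_reversed[OF that, of \<mu> h G 0] by (simp add: t_def n_def)
  have split: "n i = n \<mu> * (\<Prod>l = \<mu> + 1..i. G l)" if "\<mu> \<le> i" for i
    unfolding n_def using that prod.ub_add_nat[of 1 \<mu> G "i - \<mu>"] by simp
  have t1: "t 1 = n \<mu>" using t[of 1] by simp
  have sl: "s (m + 1) = h ^ m" using s[of "m + 1"] by (simp add: k)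
  \<comment> \<open>The two partial products meet at \<mu>: \<open>t 1\<close> supplies the nodes up
    to \<mu> and \<open>s j\<close> those from \<mu> + 1 to k - j.\<close>
  have ts: "t 1 * s j = h ^ (j - 1) * n (k - j)" if "j \<in> {1..m + 1}" for j
    using that s[of j] split[of "k - j"] unfolding t1 by (auto simp: k)
  have "?L = (\<Sum>j = 1..m + 1. (if j = 1 then t 1 * (G k * p k) * s j else 0) +
      t 1 * (h * p (k - j)) * s j +
      (if j = m + 1 then (\<Sum>i = 2..\<mu> + 1. t i * (h * p (\<mu> + 1 - i))) * s j else 0))"
  proof (intro sum.cong refl)
    fix j
    have "(\<Sum>i = 1..\<mu> + 1. t i *
      ((if i = 1 \<and> j = 1 then G k * p k else 0) + (if i = 1 then h * p (k - j) else 0) +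
       (if j = m + 1 \<and> i \<noteq> 1 then h * p (\<mu> + 1 - i) else 0))) =
      t 1 * ((if j = 1 then G k * p k else 0) + h * p (k - j)) +
      (\<Sum>i = 2..\<mu> + 1. t i * (if j = m + 1 then h * p (\<mu> + 1 - i) else 0))"
      by (subst sum.atLeast_Suc_atMost) (auto intro!: sum.cong simp: numeral_2_eq_2)
    then show "(\<Sum>i = 1..\<mu> + 1. t i *
      ((if i = 1 \<and> j = 1 then G k * p k else 0) + (if i = 1 then h * p (k - j) else 0) +
       (if j = m + 1 \<and> i \<noteq> 1 then h * p (\<mu> + 1 - i) else 0))) * s j =
      (if j = 1 then t 1 * (G k * p k) * s j else 0) + t 1 * (h * p (k - j)) * s j +
      (if j = m + 1 then (\<Sum>i = 2..\<mu> + 1. t i * (h * p (\<mu> + 1 - i))) * s j else 0)"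
      by (simp add: algebra_simps)
  qed
  also have "\<dots> = (t 1 * s 1) * (G k * p k) + (\<Sum>j = 1..m + 1. t 1 * (h * p (k - j)) * s j) +
      (\<Sum>i = 2..\<mu> + 1. t i * (h * p (\<mu> + 1 - i))) * h ^ m"
    unfolding sum.distrib using sl by (simp add: sum.delta mult_ac)
  \<comment> \<open>The corner block supplies the factor \<open>G k\<close> that completes the
    Newton polynomial of index k - 1 to that of index k.\<close>
  also have "(t 1 * s 1) * (G k * p k) = p k * (h ^ (k - k) * n k)"
    using ts[of 1] by (simp add: n_def k)
  also have "(\<Sum>j = 1..m + 1. t 1 * (h * p (k - j)) * s j) = (\<Sum>i = \<mu>..<k. p i * (h ^ (k - i) * n i))"
  proof (rule sum.reindex_bij_witness[where i = "\<lambda>i. k - i" and j = "\<lambda>j. k - j"])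
    fix j assume j: "j \<in> {1..m + 1}"
    then have "k - (k - j) = j" "h ^ j = h * h ^ (j - 1)"
      by (cases j; simp add: k)+
    then show "p (k - j) * (h ^ (k - (k - j)) * n (k - j)) = t 1 * (h * p (k - j)) * s j"
      using ts[OF j] by (simp add: mult_ac)
  qed (auto simp: k)
  also have "(\<Sum>i = 2..\<mu> + 1. t i * (h * p (\<mu> + 1 - i))) * h ^ m = (\<Sum>i = 0..<\<mu>. p i * (h ^ (k - i) * n i))"
    unfolding sum_distrib_right
  proof (rule sum.reindex_bij_witness[where i = "\<lambda>i. \<mu> + 1 - i" and j = "\<lambda>i. \<mu> + 1 - i"])
    fix i assume i: "i \<in> {2..\<mu> + 1}"
    \<comment> \<open>The exponent collects i - 1 factors from \<open>t i\<close>, one from the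
      entry of \<open>M\<close>, and m from \<open>s (m + 1)\<close>.\<close>
    then have "k - (\<mu> + 1 - i) = Suc (i - 1 + m)" by (auto simp: k)
    then have "h ^ (k - (\<mu> + 1 - i)) = h * h ^ (i - 1) * h ^ m"
      by (simp only: power_Suc power_add mult.assoc)
    then show "p (\<mu> + 1 - i) * (h ^ (k - (\<mu> + 1 - i)) * n (\<mu> + 1 - i)) =
        t i * (h * p (\<mu> + 1 - i)) * h ^ m"
      using i t[of i] by (simp add: mult_ac)
  qed auto
  also have "p k * (h ^ (k - k) * n k) + (\<Sum>i = \<mu>..<k. p i * (h ^ (k - i) * n i)) +
      (\<Sum>i = 0..<\<mu>. p i * (h ^ (k - i) * n i)) = (\<Sum>i = 0..k. p i * (h ^ (k - i) * n i))"
  proof -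
    have "{0..k} = insert k ({0..<\<mu>} \<union> {\<mu>..<k})" by (auto simp: k)
    then have "sum f {0..k} = f k + (sum f {0..<\<mu>} + sum f {\<mu>..<k})" for f :: "nat \<Rightarrow> 'a"
      by (simp add: k sum.union_disjoint)
    then show ?thesis by (simp add: add_ac)
  qed
  finally show ?thesis by (simp add: n_def)
qed

text \<open>Since the blocks of both kernel columns are scalar, entry (a, b) of the product is a
  weighted sum of the entries (a, b) of the blocks of \<open>M\<close>, and the scalar identity
  applies to each pair separately.\<close>

lemma newton_M_compression:
  assumes k: "k = m + \<mu> + 1" and P: "\<And>i. i \<le> k \<Longrightarrow> P i \<in> carrier_mat n n"
  shows "(bidiag_ker n \<mu> (newton_h e) (\<lambda>i. newton_g x e (\<mu> + 1 - i)))\<^sup>T *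
      map_mat (lin_at e) (newton_M n k \<mu> x P) *
      bidiag_ker n m (newton_h e) (\<lambda>i. newton_g x e (k - i)) =
    mat_at_eigval k (newton_poly_mat n k x P) e" (is "?L2\<^sup>T * ?M * ?L1 = ?Q")
proof (rule eq_matI)
  let ?s = "bidiag_coeff m (newton_h e) (\<lambda>i. newton_g x e (k - i))"
  let ?t = "bidiag_coeff \<mu> (newton_h e) (\<lambda>i. newton_g x e (\<mu> + 1 - i))"
  have Q: "?Q \<in> carrier_mat n n"
    by (rule mat_at_eigval_carrier[OF newton_poly_mat_carrier])
  have L2: "?L2\<^sup>T \<in> carrier_mat n ((\<mu> + 1) * n)"
    unfolding transpose_carrier_mat by (rule bidiag_ker_carrier)
  have M: "?M \<in> carrier_mat ((\<mu> + 1) * n) ((m + 1) * n)"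
    using block_mat_carrier[of n "\<mu> + 1" "m + 1"] unfolding newton_M_def k by simp
  fix a b assume "a < dim_row ?Q" "b < dim_col ?Q"
  then have a: "a < n" and b: "b < n" using Q by auto
  have L2M: "(?L2\<^sup>T * ?M) $$ (a, (j - 1) * n + b) =
      (\<Sum>i = 1..\<mu> + 1. ?t i * ?M $$ ((i - 1) * n + a, (j - 1) * n + b))" if j: "j \<in> {1..m + 1}" for j
  proof -
    have "(?L2\<^sup>T * ?M) $$ (a, (j - 1) * n + b) = (\<Sum>i = 1..\<mu> + 1. \<Sum>a' = 0..<n.
        ?L2\<^sup>T $$ (a, (i - 1) * n + a') * ?M $$ ((i - 1) * n + a', (j - 1) * n + b))"
      by (rule mult_mat_index_blocks[OF L2 M a block_index_less[OF j b]])
    also have "\<dots> = (\<Sum>i = 1..\<mu> + 1. \<Sum>a' = 0..<n. if a' = a then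
        ?t i * ?M $$ ((i - 1) * n + a', (j - 1) * n + b) else 0)"
    proof (intro sum.cong refl)
      fix i a' assume i: "i \<in> {1..\<mu> + 1}" and "a' \<in> {0..<n}"
      then have a': "a' < n" by simp
      have "?L2\<^sup>T $$ (a, (i - 1) * n + a') = ?L2 $$ ((i - 1) * n + a', a)"
        using carrier_matD[OF bidiag_ker_carrier[of n \<mu> "newton_h e"
              "\<lambda>i. newton_g x e (\<mu> + 1 - i)"]] block_index_less[OF i a'] a
        by (intro index_transpose_mat) auto
      then show "?L2\<^sup>T $$ (a, (i - 1) * n + a') * ?M $$ ((i - 1) * n + a', (j - 1) * n + b) =
          (if a' = a then ?t i * ?M $$ ((i - 1) * n + a', (j - 1) * n + b) else 0)"
        unfolding index_bidiag_ker[OF i a' a] by simp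
    qed
    finally show ?thesis unfolding sum_if_delta[OF a] .
  qed
  have "(?L2\<^sup>T * ?M * ?L1) $$ (a, b) = (\<Sum>j = 1..m + 1. \<Sum>b' = 0..<n.
      (?L2\<^sup>T * ?M) $$ (a, (j - 1) * n + b') * ?L1 $$ ((j - 1) * n + b', b))"
    by (rule mult_mat_index_blocks[OF mult_carrier_mat[OF L2 M] bidiag_ker_carrier a b])
  also have "\<dots> = (\<Sum>j = 1..m + 1. \<Sum>b' = 0..<n. if b' = b then
      (?L2\<^sup>T * ?M) $$ (a, (j - 1) * n + b') * ?s j else 0)"
    using b by (intro sum.cong refl) (simp add: index_bidiag_ker del: One_nat_def)
  also have "\<dots> = (\<Sum>j = 1..m + 1.
      (\<Sum>i = 1..\<mu> + 1. ?t i * ?M $$ ((i - 1) * n + a, (j - 1) * n + b)) * ?s j)"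
    unfolding sum_if_delta[OF b] by (intro sum.cong refl) (simp only: L2M)
  also have "\<dots> = (\<Sum>j = 1..m + 1. (\<Sum>i = 1..\<mu> + 1. ?t i *
      ((if i = 1 \<and> j = 1 then newton_g x e k * P k $$ (a, b) else 0) +
       (if i = 1 then newton_h e * P (k - j) $$ (a, b) else 0) +
       (if j = m + 1 \<and> i \<noteq> 1 then newton_h e * P (\<mu> + 1 - i) $$ (a, b) else 0))) * ?s j)"
  proof (intro sum.cong refl arg_cong2[where f = "(*)"])
    fix i j assume i: "i \<in> {1..\<mu> + 1}" and j: "j \<in> {1..m + 1}"
    then have "j \<in> {1..k - \<mu>}" by (simp add: k)
    from lin_at_newton_M_index[OF i this a b P, where e = e and x = x]
    show "?M $$ ((i - 1) * n + a, (j - 1) * n + b) =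
      (if i = 1 \<and> j = 1 then newton_g x e k * P k $$ (a, b) else 0) +
       (if i = 1 then newton_h e * P (k - j) $$ (a, b) else 0) +
       (if j = m + 1 \<and> i \<noteq> 1 then newton_h e * P (\<mu> + 1 - i) $$ (a, b) else 0)"
      by (simp add: k)
  qed
  also have "\<dots> = (\<Sum>i = 0..k. P i $$ (a, b) *
      (newton_h e ^ (k - i) * (\<Prod>l = 1..i. newton_g x e l)))"
    by (rule newton_sum_identity[OF k])
  finally show "(?L2\<^sup>T * ?M * ?L1) $$ (a, b) = ?Q $$ (a, b)"
    by (simp only: mat_at_eigval_newton_index[OF a b])
qed (use carrier_matD[OF mat_at_eigval_carrier[OF newton_poly_mat_carrier[of n k x P]]]
    carrier_matD[OF bidiag_ker_carrier] in auto)

section \<open>Eigenvectors of the Newton pencil\<close>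

text \<open>Turns the condition for a left eigenvector into one for a null vector of the transpose,
  by commutativity of the scalar product.\<close>

lemma mat_of_row_mult_eq_0_iff:
  fixes X :: "'a::comm_semiring_0 mat"
  assumes "X \<in> carrier_mat nr nc" "v \<in> carrier_vec nr"
  shows "mat_of_row v * X = 0\<^sub>m 1 nc \<longleftrightarrow> X\<^sup>T *\<^sub>v v = 0\<^sub>v nc"
proof -
  have "(mat_of_row v * X) $$ (0, j) = (X\<^sup>T *\<^sub>v v) $ j" if "j < nc" for j
    using assms that comm_scalar_prod[of v nr "col X j"] by simp
  then show ?thesis
    using assms by (auto simp: mat_eq_iff vec_eq_iff)
qed

lemma right_eigenvector_iff:
  assumes "X \<in> carrier_mat nr nc"
  shows "right_eigenvector k X e v \<longleftrightarrow>
    v \<in> carrier_vec nc \<and> v \<noteq> 0\<^sub>v nc \<and> mat_at_eigval k X e *\<^sub>v v = 0\<^sub>v nr"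
  using assms by (auto simp: right_eigenvector_def)

lemma left_eigenvector_iff:
  assumes "X \<in> carrier_mat nr nc"
  shows "left_eigenvector k X e v \<longleftrightarrow>
    v \<in> carrier_vec nr \<and> v \<noteq> 0\<^sub>v nr \<and> (mat_at_eigval k X e)\<^sup>T *\<^sub>v v = 0\<^sub>v nc"
  using assms mat_of_row_mult_eq_0_iff[OF mat_at_eigval_carrier[OF assms], of v k e]
  by (auto simp: left_eigenvector_def)

lemma right_eigenvector_smult:
  assumes "right_eigenvector k X e v" "a \<noteq> 0"
  shows "right_eigenvector k X e (a \<cdot>\<^sub>v v)"
proof -
  have X: "X \<in> carrier_mat (dim_row X) (dim_col X)" by simp
  have "a \<cdot>\<^sub>v v = 0\<^sub>v (dim_col X) \<longleftrightarrow> v = 0\<^sub>v (dim_col X)" if "v \<in> carrier_vec (dim_col X)"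
    using that assms(2) by (auto simp: vec_eq_iff)
  then show ?thesis
    using assms unfolding right_eigenvector_def
    by (auto simp: mult_mat_vec[OF mat_at_eigval_carrier[OF X]])
qed

lemma left_eigenvector_smult:
  assumes "left_eigenvector k X e v" "a \<noteq> 0"
  shows "left_eigenvector k X e (a \<cdot>\<^sub>v v)"
proof -
  have X: "X \<in> carrier_mat (dim_row X) (dim_col X)" by simp
  have XT: "(mat_at_eigval k X e)\<^sup>T \<in> carrier_mat (dim_col X) (dim_row X)"
    using mat_at_eigval_carrier[OF X] by simp
  have "a \<cdot>\<^sub>v v = 0\<^sub>v (dim_row X) \<longleftrightarrow> v = 0\<^sub>v (dim_row X)" if "v \<in> carrier_vec (dim_row X)"
    using that assms(2) by (auto simp: vec_eq_iff)
  then show ?thesis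
    using assms unfolding left_eigenvector_iff[OF X] by (auto simp: mult_mat_vec[OF XT])
qed

text \<open>Reduces left null vectors to right ones: \<open>B\<^sup>T\<close> takes the place of
  \<open>A\<close>, \<open>A\<^sup>T\<close> that of \<open>B\<close>, and \<open>K\<^sub>1\<close>,
  \<open>K\<^sub>2\<close> are exchanged.\<close>

lemma transpose_kronecker_pencil:
  fixes M :: "'a::comm_ring_1 mat"
  assumes M: "M \<in> carrier_mat c\<^sub>2 c\<^sub>1" and A: "A \<in> carrier_mat c\<^sub>2 r\<^sub>1"
    and B: "B \<in> carrier_mat r\<^sub>2 c\<^sub>1" and K1: "K\<^sub>1 \<in> carrier_mat r\<^sub>1 c\<^sub>1"
    and K2: "K\<^sub>2 \<in> carrier_mat r\<^sub>2 c\<^sub>2"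
  shows "(four_block_mat (M + A * K\<^sub>1 + K\<^sub>2\<^sup>T * B) K\<^sub>2\<^sup>T K\<^sub>1 (0\<^sub>m r\<^sub>1 r\<^sub>2))\<^sup>T =
    four_block_mat (M\<^sup>T + B\<^sup>T * K\<^sub>2 + K\<^sub>1\<^sup>T * A\<^sup>T) K\<^sub>1\<^sup>T K\<^sub>2 (0\<^sub>m r\<^sub>2 r\<^sub>1)"
proof -
  have K2T: "K\<^sub>2\<^sup>T \<in> carrier_mat c\<^sub>2 r\<^sub>2" using K2 by simp
  have AK: "A * K\<^sub>1 \<in> carrier_mat c\<^sub>2 c\<^sub>1" and KB: "K\<^sub>2\<^sup>T * B \<in> carrier_mat c\<^sub>2 c\<^sub>1"
    using A B K1 K2T by auto
  have MAK: "M + A * K\<^sub>1 \<in> carrier_mat c\<^sub>2 c\<^sub>1" using M AK by simp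
  have "(M + A * K\<^sub>1 + K\<^sub>2\<^sup>T * B)\<^sup>T = M\<^sup>T + K\<^sub>1\<^sup>T * A\<^sup>T + B\<^sup>T * K\<^sub>2"
    by (simp add: transpose_add[OF MAK KB] transpose_add[OF M AK] transpose_mult[OF A K1]
        transpose_mult[OF K2T B])
  also have "\<dots> = M\<^sup>T + B\<^sup>T * K\<^sub>2 + K\<^sub>1\<^sup>T * A\<^sup>T"
    using M A B K1 K2 by (intro eq_matI) auto
  finally show ?thesis
    by (simp add: transpose_four_block_mat[OF add_carrier_mat[OF KB] K2T K1 zero_carrier_mat])
qed

theorem theorem3p10:
  fixes n k \<mu> :: nat
    and x :: "nat \<Rightarrow> complex"
    and Pc :: "nat \<Rightarrow> complex mat"
    and P N :: "complex poly mat"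
    and A B :: "complex mat"
    and e :: eigval
    and z \<omega> :: "complex vec"
  assumes "k \<ge> 1"
    and "inj_on x {1..k}"
    and "\<And>i. i \<le> k \<Longrightarrow> Pc i \<in> carrier_mat n n"
    and "P = newton_poly_mat n k x Pc"
    and "regular_poly_mat P"
    and "poly_eigenvalue k P e"
    and "\<mu> \<le> k - 1"
    and "A \<in> carrier_mat ((\<mu> + 1) * n) ((k - \<mu> - 1) * n)"
    and "B \<in> carrier_mat (\<mu> * n) ((k - \<mu>) * n)"
    and "N = four_block_mat
           (newton_M n k \<mu> x Pc + const_poly_mat A * newton_K1 n k \<mu> x
              + transpose_mat (newton_K2 n \<mu> x) * const_poly_mat B)
           (transpose_mat (newton_K2 n \<mu> x))
           (newton_K1 n k \<mu> x)
           (0\<^sub>m ((k - \<mu> - 1) * n) (\<mu> * n))"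
    and "right_eigenvector 1 N e z"
    and "left_eigenvector 1 N e \<omega>"
  shows "(\<forall>c. e = Fin c \<longrightarrow>
            right_eigenvector k P e (block_vec n z (k - \<mu>)) \<and>
            (c \<notin> x ` {\<mu> + 1..k - 1} \<longrightarrow>
               (\<forall>i \<in> {1..k - \<mu>}. right_eigenvector k P e (block_vec n z i))) \<and>
            left_eigenvector k P e (block_vec n \<omega> (\<mu> + 1)) \<and>
            (c \<notin> x ` {1..\<mu>} \<longrightarrow>
               (\<forall>i \<in> {1..\<mu> + 1}. left_eigenvector k P e (block_vec n \<omega> i)))) \<and>
         (e = Infty \<longrightarrow>
            right_eigenvector k P e (block_vec n z 1) \<and>
            left_eigenvector k P e (block_vec n \<omega> 1))"
proof -
  let ?h = "newton_h e"
  define m where "m = k - \<mu> - 1"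
  \<comment> \<open>With m the number of block rows of \<open>K\<^sub>1\<close>, all truncated
    differences of k and \<mu> become sums, and m and \<mu> play symmetric roles.\<close>
  have k: "k = m + \<mu> + 1" and km: "k - \<mu> - 1 = m" "k - \<mu> = m + 1" "m + 1 - 1 = m"
    using assms(1,7) by (auto simp: m_def)
  define g\<^sub>1 g\<^sub>2 where "g\<^sub>1 = (\<lambda>i. newton_g x e (k - i))" and "g\<^sub>2 = (\<lambda>i. newton_g x e (\<mu> + 1 - i))"
  define M where "M = map_mat (lin_at e) (newton_M n k \<mu> x Pc)"
  define K\<^sub>1 K\<^sub>2 where "K\<^sub>1 = bidiag_mat n m ?h g\<^sub>1" and "K\<^sub>2 = bidiag_mat n \<mu> ?h g\<^sub>2"
  define L\<^sub>1 L\<^sub>2 where "L\<^sub>1 = bidiag_ker n m ?h g\<^sub>1" and "L\<^sub>2 = bidiag_ker n \<mu> ?h g\<^sub>2"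
  define Q where "Q = mat_at_eigval k P e"
  have A: "A \<in> carrier_mat ((\<mu> + 1) * n) (m * n)" and B: "B \<in> carrier_mat (\<mu> * n) ((m + 1) * n)"
    using assms(8,9) unfolding km .
  have nM: "newton_M n k \<mu> x Pc \<in> carrier_mat ((\<mu> + 1) * n) ((m + 1) * n)"
    unfolding newton_M_def km by (rule block_mat_carrier)
  have nK1: "newton_K1 n k \<mu> x \<in> carrier_mat (m * n) ((m + 1) * n)"
    unfolding newton_K1_def km by (rule block_mat_carrier)
  have nK2: "(newton_K2 n \<mu> x)\<^sup>T \<in> carrier_mat ((\<mu> + 1) * n) (\<mu> * n)"
    unfolding newton_K2_def transpose_carrier_mat by (rule block_mat_carrier)
  have cA: "const_poly_mat A \<in> carrier_mat ((\<mu> + 1) * n) (m * n)"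
    and cB: "const_poly_mat B \<in> carrier_mat (\<mu> * n) ((m + 1) * n)"
    using A B by (simp_all only: const_poly_mat_def map_carrier_mat)
  note AK = mult_carrier_mat[OF cA nK1] and KB = mult_carrier_mat[OF nK2 cB]
  note MAK = add_carrier_mat[OF AK, of "newton_M n k \<mu> x Pc"]
  note TL = add_carrier_mat[OF KB, of "newton_M n k \<mu> x Pc + const_poly_mat A * newton_K1 n k \<mu> x"]
  have M: "M \<in> carrier_mat ((\<mu> + 1) * n) ((m + 1) * n)"
    using nM by (simp only: M_def map_carrier_mat)
  have K1: "K\<^sub>1 \<in> carrier_mat (m * n) ((m + 1) * n)" and K2: "K\<^sub>2 \<in> carrier_mat (\<mu> * n) ((\<mu> + 1) * n)"
    by (simp_all only: K\<^sub>1_def K\<^sub>2_def bidiag_mat_carrier)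
  have P: "P \<in> carrier_mat n n"
    unfolding assms(4) by (rule newton_poly_mat_carrier)
  have N: "N \<in> carrier_mat ((\<mu> + 1) * n + m * n) ((m + 1) * n + \<mu> * n)"
    unfolding assms(10) km by (rule four_block_carrier_mat[OF TL zero_carrier_mat])
  have N_at: "mat_at_eigval 1 N e =
      four_block_mat (M + A * K\<^sub>1 + K\<^sub>2\<^sup>T * B) K\<^sub>2\<^sup>T K\<^sub>1 (0\<^sub>m (m * n) (\<mu> * n))"
  proof -
    have mK1: "map_mat (lin_at e) (newton_K1 n k \<mu> x) = K\<^sub>1"
      unfolding K\<^sub>1_def g\<^sub>1_def by (rule map_lin_at_newton_K1[OF k])
    have mK2: "map_mat (lin_at e) (newton_K2 n \<mu> x)\<^sup>T = K\<^sub>2\<^sup>T"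
      unfolding K\<^sub>2_def g\<^sub>2_def map_mat_transpose[symmetric] map_lin_at_newton_K2 ..
    have m0: "map_mat (lin_at e) (0\<^sub>m (m * n) (\<mu> * n)) = 0\<^sub>m (m * n) (\<mu> * n)"
      by (intro eq_matI) auto
    show ?thesis
      unfolding assms(10) km mat_at_eigval_1 map_four_block_mat[OF TL nK2 nK1 zero_carrier_mat]
        map_lin_at_add[OF MAK KB] map_lin_at_add[OF nM AK] map_lin_at_const_mult[OF A nK1]
        map_lin_at_mult_const[OF nK2 B] mK1 mK2 m0 M_def ..
  qed
  \<comment> \<open>The first alternative is the finite case, the second is infinity.\<close>
  have hg: "?h = 1 \<or> ?h = 0 \<and> (\<forall>i. g\<^sub>1 i = 1) \<and> (\<forall>i. g\<^sub>2 i = 1)"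
    by (cases e) (simp_all add: g\<^sub>1_def g\<^sub>2_def)
  have Q: "L\<^sub>2\<^sup>T * M * L\<^sub>1 = Q"
    unfolding L\<^sub>1_def L\<^sub>2_def g\<^sub>1_def g\<^sub>2_def M_def Q_def assms(4)
    by (rule newton_M_compression[OF k assms(3)])
  have L1: "L\<^sub>1 \<in> carrier_mat ((m + 1) * n) n" and L2: "L\<^sub>2 \<in> carrier_mat ((\<mu> + 1) * n) n"
    by (simp_all only: L\<^sub>1_def L\<^sub>2_def bidiag_ker_carrier)
  have MT: "M\<^sup>T \<in> carrier_mat ((m + 1) * n) ((\<mu> + 1) * n)"
    and AT: "A\<^sup>T \<in> carrier_mat (m * n) ((\<mu> + 1) * n)"
    and BT: "B\<^sup>T \<in> carrier_mat ((m + 1) * n) (\<mu> * n)"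
    and L1T: "L\<^sub>1\<^sup>T \<in> carrier_mat n ((m + 1) * n)"
    and L2T: "L\<^sub>2\<^sup>T \<in> carrier_mat n ((\<mu> + 1) * n)"
    using M A B L1 L2 by (simp_all only: transpose_carrier_mat)
  have "Q\<^sup>T = L\<^sub>1\<^sup>T * (M\<^sup>T * L\<^sub>2)"
    unfolding Q[symmetric] transpose_mult[OF mult_carrier_mat[OF L2T M] L1] transpose_mult[OF L2T M]
    by simp
  \<comment> \<open>The compression for the transposed pencil is the transposed value of
    \<open>P\<close>, whose null vectors give left eigenvectors.\<close>
  then have QT: "L\<^sub>1\<^sup>T * M\<^sup>T * L\<^sub>2 = Q\<^sup>T"
    by (simp only: assoc_mult_mat[OF L1T MT L2])

  have z: "z \<in> carrier_vec ((m + 1) * n + \<mu> * n)" "z \<noteq> 0\<^sub>v ((m + 1) * n + \<mu> * n)"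
    and Nz: "four_block_mat (M + A * K\<^sub>1 + K\<^sub>2\<^sup>T * B) K\<^sub>2\<^sup>T K\<^sub>1 (0\<^sub>m (m * n) (\<mu> * n)) *\<^sub>v z =
      0\<^sub>v ((\<mu> + 1) * n + m * n)"
    using assms(11) unfolding right_eigenvector_iff[OF N] N_at by blast+
  have \<omega>: "\<omega> \<in> carrier_vec ((\<mu> + 1) * n + m * n)" "\<omega> \<noteq> 0\<^sub>v ((\<mu> + 1) * n + m * n)"
    and N\<omega>: "four_block_mat (M\<^sup>T + B\<^sup>T * K\<^sub>2 + K\<^sub>1\<^sup>T * A\<^sup>T) K\<^sub>1\<^sup>T K\<^sub>2 (0\<^sub>m (\<mu> * n) (m * n)) *\<^sub>v \<omega> =
      0\<^sub>v ((m + 1) * n + \<mu> * n)"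
    using assms(12) unfolding left_eigenvector_iff[OF N] N_at
      transpose_kronecker_pencil[OF M A B K1 K2] by blast+
  have hg': "?h = 1 \<or> ?h = 0 \<and> (\<forall>i. g\<^sub>2 i = 1) \<and> (\<forall>i. g\<^sub>1 i = 1)" using hg by blast
  \<comment> \<open>The blocks of \<open>z\<close> and \<omega> that are eigenvectors without any
    condition on the nodes.\<close>
  define r l where "r = (if ?h = 1 then m + 1 else 1)" and "l = (if ?h = 1 then \<mu> + 1 else 1)"
  note right = bidiag_kronecker_null_vec[OF M A B hg r_def z Nz[unfolded K\<^sub>1_def K\<^sub>2_def],
      folded L\<^sub>1_def L\<^sub>2_def, unfolded Q]
  note left = bidiag_kronecker_null_vec[OF MT BT AT hg' l_def \<omega> N\<omega>[unfolded K\<^sub>1_def K\<^sub>2_def],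
      folded L\<^sub>1_def L\<^sub>2_def, unfolded QT]
  have right_r: "right_eigenvector k P e (block_vec n z r)"
    unfolding right_eigenvector_iff[OF P] using right(1,2) by (simp add: Q_def)
  have left_l: "left_eigenvector k P e (block_vec n \<omega> l)"
    unfolding left_eigenvector_iff[OF P] using left(1,2) by (simp add: Q_def)
  \<comment> \<open>Every block of the upper part is a multiple of block \<open>r\<close>, so only
    the vanishing of the factor can spoil the eigenvector property.\<close>
  have right_all: "right_eigenvector k P e (block_vec n z i)"
    if "bidiag_coeff m ?h g\<^sub>1 i \<noteq> 0" "i \<in> {1..m + 1}" for i
    unfolding right(3)[OF that(2)] using right_r that(1) by (rule right_eigenvector_smult)
  have left_all: "left_eigenvector k P e (block_vec n \<omega> i)"
    if "bidiag_coeff \<mu> ?h g\<^sub>2 i \<noteq> 0" "i \<in> {1..\<mu> + 1}" for i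
    unfolding left(3)[OF that(2)] using left_l that(1) by (rule left_eigenvector_smult)
  \<comment> \<open>At a finite eigenvalue \<open>h\<close> is 1, and the coefficient is the product
    of \<open>c - x (k - j)\<close> with j from i to m. The indices k - j lie between \<mu> + 1 and
    k - 1, the range of excluded nodes; for i = m + 1 the product is empty.\<close>
  have c1: "bidiag_coeff m ?h g\<^sub>1 i \<noteq> 0"
    if e: "e = Fin c" and c: "c \<notin> x ` {\<mu> + 1..k - 1}" and i: "i \<in> {1..m + 1}" for c i
  proof -
    have "g\<^sub>1 j \<noteq> 0" if "j \<in> {i..m}" for j
    proof -
      have "k - j \<in> {\<mu> + 1..k - 1}" using that i by (auto simp: k)
      then have "c \<noteq> x (k - j)" using c by blast
      then show ?thesis by (simp add: g\<^sub>1_def e)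
    qed
    then show ?thesis by (simp add: bidiag_coeff_def e)
  qed
  \<comment> \<open>The same argument, where the indices \<mu> + 1 - j lie between 1 and
    \<mu>.\<close>
  have c2: "bidiag_coeff \<mu> ?h g\<^sub>2 i \<noteq> 0"
    if e: "e = Fin c" and c: "c \<notin> x ` {1..\<mu>}" and i: "i \<in> {1..\<mu> + 1}" for c i
  proof -
    have "g\<^sub>2 j \<noteq> 0" if "j \<in> {i..\<mu>}" for j
    proof -
      have "\<mu> + 1 - j \<in> {1..\<mu>}" using that i by auto
      then have "c \<noteq> x (\<mu> + 1 - j)" using c by blast
      then show ?thesis by (simp add: g\<^sub>2_def e)
    qed
    then show ?thesis by (simp add: bidiag_coeff_def e)
  qed
  show ?thesis
  proof (cases e)
    case (Fin c)
    then have "r = m + 1" "l = \<mu> + 1" by (simp_all add: r_def l_def)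
    then show ?thesis
      using Fin right_r left_l right_all left_all c1 c2 unfolding km by auto
  next
    case Infty
    then have "r = 1" "l = 1" by (simp_all add: r_def l_def)
    then show ?thesis using Infty right_r left_l by simp
  qed
qed

end
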